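(* Let $R>0$, $b>0$, $\alpha>0$, $n\in\mathbb{R}$, $c\in[0,1]$, $Cu\ge 0$, and suppose that at least one of $c=0$, $Cu=0$, $n=1$ holds. Then the boundary value problem $$\frac{1}{Y}\frac{d}{dY}\left\{\left[1-c+c\left(1+Cu^\alpha |U_Y|^\alpha\right)^{\frac{n-1}{\alpha}}\right]Y\,U_Y\right\}=b \quad\text{for } Y\in(0,R),\qquad U_Y(0)=U(R)=0,$$ is the Newtonian one (the classical Poiseuille problem in a pipe, in which the factor in square brackets equals $1$) and has a unique classical solution, given by $$U(Y)=\frac{b}{4}\left(Y^2-R^2\right)\quad\text{for every } Y\in[0,R].$$
   Context: $U=U(Y)$ is a real-valued function on $[0,R]$ and $U_Y=dU/dY$. $Cu$ is a single symbol (a real number, the Carreau number) and $Cu^\alpha$ denotes its $\alpha$-th power. A classical solution is a function $U\in C^2((0,R))\cap C^1([0,R])$ satisfying the equation pointwise in $(0,R)$ and the boundary conditions $U_Y(0)=U(R)=0$. *)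

theory Defs
  imports "HOL-Analysis.Analysis"
begin

text \<open>Derivatives are taken relative to \<open>S\<close>: ordinary ones if \<open>S\<close> is open, one-sided at the
  endpoints if \<open>S\<close> is a compact interval. (The library's \<open>C1_differentiable_on\<close> would require
  two-sided derivatives at the endpoints.)\<close>

definition C1_on :: "real set \<Rightarrow> (real \<Rightarrow> real) \<Rightarrow> bool" where
  "C1_on S f \<longleftrightarrow>
     (\<exists>f'. (\<forall>x\<in>S. (f has_real_derivative f' x) (at x within S)) \<and> continuous_on S f')"

definition C2_on :: "real set \<Rightarrow> (real \<Rightarrow> real) \<Rightarrow> bool" where
  "C2_on S f \<longleftrightarrow>
     (\<exists>f'. (\<forall>x\<in>S. (f has_real_derivative f' x) (at x within S)) \<and> C1_on S f')"

text \<open>The derivative \<open>U\<^sub>Y\<close> of a function on \<open>[0,R]\<close>; it only depends on the values on \<open>[0,R]\<close>.\<close>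

definition slope :: "real \<Rightarrow> (real \<Rightarrow> real) \<Rightarrow> real \<Rightarrow> real" where
  "slope R U Y = vector_derivative U (at Y within {0..R})"

text \<open>The factor in square brackets, as a function of the slope \<open>p = U\<^sub>Y\<close>. Since \<open>0 powr \<alpha> = 0\<close>, the
  real powers have their usual meaning for all \<open>\<alpha> > 0\<close>, \<open>Cu \<ge> 0\<close> and \<open>p\<close>.\<close>

definition carreau_factor :: "real \<Rightarrow> real \<Rightarrow> real \<Rightarrow> real \<Rightarrow> real \<Rightarrow> real" where
  "carreau_factor \<alpha> n c Cu p =
     1 - c + c * (1 + Cu powr \<alpha> * \<bar>p\<bar> powr \<alpha>) powr ((n - 1) / \<alpha>)"

text \<open>Classical solutions of
  \<open>(1/Y) d/dY {\<mu>(U\<^sub>Y) Y U\<^sub>Y} = b\<close> on \<open>(0,R)\<close>, \<open>U\<^sub>Y(0) = U(R) = 0\<close>.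
  Differentiability of the expression in braces is explicit because \<open>deriv\<close> is total and \<open>\<mu>\<close> need
  not be smooth.\<close>

definition classical_solution ::
    "real \<Rightarrow> real \<Rightarrow> (real \<Rightarrow> real) \<Rightarrow> (real \<Rightarrow> real) \<Rightarrow> bool" where
  "classical_solution R b \<mu> U \<longleftrightarrow>
     C2_on {0<..<R} U \<and> C1_on {0..R} U \<and>
     (\<forall>Y\<in>{0<..<R}.
        (\<lambda>y. \<mu> (slope R U y) * y * slope R U y) field_differentiable (at Y) \<and>
        1 / Y * deriv (\<lambda>y. \<mu> (slope R U y) * y * slope R U y) Y = b) \<and>
     slope R U 0 = 0 \<and> U R = 0"

definition carreau_solution ::
    "real \<Rightarrow> real \<Rightarrow> real \<Rightarrow> real \<Rightarrow> real \<Rightarrow> real \<Rightarrow> (real \<Rightarrow> real) \<Rightarrow> bool" where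
  "carreau_solution R b \<alpha> n c Cu = classical_solution R b (carreau_factor \<alpha> n c Cu)"

definition poiseuille_solution :: "real \<Rightarrow> real \<Rightarrow> (real \<Rightarrow> real) \<Rightarrow> bool" where
  "poiseuille_solution R b = classical_solution R b (\<lambda>p. 1)"

end

theory Submission
  imports Defs
begin

text \<open>In each of the three cases the factor in square brackets is constantly \<open>1\<close>, so the equation
  is the linear one, \<open>(Y U\<^sub>Y)\<^sub>Y = b Y\<close> on \<open>(0,R)\<close>. A solution is found by integrating twice. The
  flux \<open>Y U\<^sub>Y\<close> has the same derivative as \<open>b Y\<^sup>2 / 2\<close> on \<open>(0,R)\<close>; both functions are continuous on
  \<open>[0,R]\<close> because \<open>U\<close> is \<open>C\<^sup>1\<close> up to the boundary, and both vanish at the axis \<open>Y = 0\<close>, so they are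
  equal. It is this regularity at the axis that excludes the singular homogeneous solution
  \<open>ln Y\<close>, whose flux is a nonzero constant. Hence \<open>U\<^sub>Y = b Y / 2\<close>, and \<open>U R = 0\<close> fixes the
  constant in the second integration.\<close>

lemma carreau_factor_newtonian:
  assumes "c = 0 \<or> Cu = 0 \<or> n = 1"
  shows "carreau_factor \<alpha> n c Cu p = 1"
proof -
  \<comment> \<open>\<open>0 powr 0 = 0\<close>, so the case \<open>n = 1\<close> needs the base to be nonzero.\<close>
  have "1 + Cu powr \<alpha> * \<bar>p\<bar> powr \<alpha> > 0"
    by (simp add: add_pos_nonneg)
  with assms show ?thesis
    by (auto simp: carreau_factor_def)
qed

lemma slope_eqI:
  assumes "R > 0" and "Y \<in> {0..R}"
    and "(U has_real_derivative d) (at Y within {0..R})"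
  shows "slope R U Y = d"
  unfolding slope_def
  using assms vector_derivative_within_cbox[of 0 R Y U d]
  by (simp add: has_real_derivative_iff_has_vector_derivative)

lemma C1_on_slope:
  assumes "R > 0" and "C1_on {0..R} U"
  shows "\<And>Y. Y \<in> {0..R} \<Longrightarrow> (U has_real_derivative slope R U Y) (at Y within {0..R})"
    and "continuous_on {0..R} (slope R U)"
proof -
  obtain u where u: "\<And>Y. Y \<in> {0..R} \<Longrightarrow> (U has_real_derivative u Y) (at Y within {0..R})"
    and cont: "continuous_on {0..R} u"
    using assms(2) unfolding C1_on_def by blast
  have eq: "slope R U Y = u Y" if "Y \<in> {0..R}" for Y
    using slope_eqI[OF assms(1) that u[OF that]] .
  show "(U has_real_derivative slope R U Y) (at Y within {0..R})" if "Y \<in> {0..R}" for Y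
    using u[OF that] eq[OF that] by simp
  show "continuous_on {0..R} (slope R U)"
    using cont by (rule continuous_on_eq) (simp add: eq)
qed

lemma continuous_antiderivatives_differ_by_constant:
  fixes f g :: "real \<Rightarrow> real"
  assumes cont: "continuous_on {a..b} f" "continuous_on {a..b} g"
    and deriv: "\<And>x. a < x \<Longrightarrow> x < b \<Longrightarrow> (f has_real_derivative h x) (at x)"
      "\<And>x. a < x \<Longrightarrow> x < b \<Longrightarrow> (g has_real_derivative h x) (at x)"
    and xy: "x \<in> {a..b}" "y \<in> {a..b}"
  shows "f x - g x = f y - g y"
proof (cases "a < b")
  case True
  have "f z - g z = f a - g a" if "z \<in> {a..b}" for z
  proof (rule DERIV_isconst2[OF True, where f = "\<lambda>z. f z - g z"])
    show "((\<lambda>z. f z - g z) has_real_derivative 0) (at z)" if "a < z" "z < b" for z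
      using DERIV_diff[OF deriv[OF that]] by simp
  qed (use cont that in \<open>auto intro!: continuous_intros\<close>)
  with xy show ?thesis by metis
next
  case False
  with xy have "x = y" by simp
  then show ?thesis by (rule arg_cong)
qed

lemma poiseuille_solution_slope:
  assumes R: "R > 0" and sol: "poiseuille_solution R b U" and Y: "Y \<in> {0..R}"
  shows "slope R U Y = b / 2 * Y"
proof (cases "Y = 0")
  case True
  with sol show ?thesis
    by (simp add: poiseuille_solution_def classical_solution_def)
next
  case False
  have C1: "C1_on {0..R} U"
    using sol by (simp add: poiseuille_solution_def classical_solution_def)
  have flux: "((\<lambda>y. y * slope R U y) has_real_derivative b * y) (at y)"
    if "0 < y" "y < R" for y
  proof -
    have "(\<lambda>y. y * slope R U y) field_differentiable (at y)"
      and "1 / y * deriv (\<lambda>y. y * slope R U y) y = b"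
      using sol that by (simp_all add: poiseuille_solution_def classical_solution_def)
    then show ?thesis
      using that DERIV_deriv_iff_field_differentiable[of "\<lambda>y. y * slope R U y" y]
      by (simp add: field_simps)
  qed
  have "Y * slope R U Y - b / 2 * Y\<^sup>2 = 0 * slope R U 0 - b / 2 * 0\<^sup>2"
  proof (rule continuous_antiderivatives_differ_by_constant[OF _ _ flux])
    show "((\<lambda>y. b / 2 * y\<^sup>2) has_real_derivative b * y) (at y)" for y
      by (auto intro!: derivative_eq_intros)
  qed (use R Y C1_on_slope(2)[OF R C1] in \<open>auto intro!: continuous_intros\<close>)
  with False show ?thesis
    by (simp add: power2_eq_square)
qed

lemma poiseuille_solution_unique:
  assumes R: "R > 0" and sol: "poiseuille_solution R b U" and Y: "Y \<in> {0..R}"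
  shows "U Y = b / 4 * (Y\<^sup>2 - R\<^sup>2)"
proof -
  have C1: "C1_on {0..R} U" and UR: "U R = 0"
    using sol by (simp_all add: poiseuille_solution_def classical_solution_def)
  have U': "(U has_real_derivative b / 2 * y) (at y within {0..R})" if "y \<in> {0..R}" for y
    using C1_on_slope(1)[OF R C1 that] poiseuille_solution_slope[OF R sol that] by simp
  have "U Y - b / 4 * Y\<^sup>2 = U R - b / 4 * R\<^sup>2"
  proof (rule continuous_antiderivatives_differ_by_constant)
    show "continuous_on {0..R} U"
      using U' by (rule DERIV_continuous_on)
    show "(U has_real_derivative b / 2 * y) (at y)" if "0 < y" "y < R" for y
      using U'[of y] that by (simp add: at_within_Icc_at)
    show "((\<lambda>y. b / 4 * y\<^sup>2) has_real_derivative b / 2 * y) (at y)" for y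
      by (auto intro!: derivative_eq_intros)
  qed (use R Y in \<open>auto intro!: continuous_intros\<close>)
  with UR show ?thesis
    by (simp add: algebra_simps)
qed

lemma poiseuille_solution_parabola:
  assumes R: "R > 0"
  shows "poiseuille_solution R b (\<lambda>Y. b / 4 * (Y\<^sup>2 - R\<^sup>2))" (is "poiseuille_solution R b ?U")
proof -
  have U': "(?U has_real_derivative b / 2 * y) (at y within S)" for y S
    by (auto intro!: derivative_eq_intros)
  have U'': "((\<lambda>y. b / 2 * y) has_real_derivative b / 2) (at y within S)" for y S
    by (auto intro!: derivative_eq_intros)
  have C1: "C1_on {0..R} ?U"
    unfolding C1_on_def using U' by (intro exI[of _ "\<lambda>y. b / 2 * y"]) (auto intro!: continuous_intros)
  have "C1_on {0<..<R} (\<lambda>y. b / 2 * y)"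
    unfolding C1_on_def using U'' by (intro exI[of _ "\<lambda>y. b / 2"]) auto
  then have C2: "C2_on {0<..<R} ?U"
    unfolding C2_on_def using U' by blast
  have slope: "slope R ?U y = b / 2 * y" if "y \<in> {0..R}" for y
    by (rule slope_eqI[OF R that U'])
  \<comment> \<open>The slope is known on \<open>[0,R]\<close> only, so the flux is replaced by \<open>b y\<^sup>2 / 2\<close> near \<open>Y\<close>.\<close>
  have flux: "((\<lambda>y. y * slope R ?U y) has_real_derivative b * Y) (at Y)" if "Y \<in> {0<..<R}" for Y
  proof (rule has_field_derivative_transform_within_open[OF _ open_greaterThanLessThan that])
    show "((\<lambda>y. y * (b / 2 * y)) has_real_derivative b * Y) (at Y)"
      by (auto intro!: derivative_eq_intros)
    show "y * (b / 2 * y) = y * slope R ?U y" if "y \<in> {0<..<R}" for y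
      using slope[of y] that by simp
  qed
  have "(\<lambda>y. y * slope R ?U y) field_differentiable (at Y)
      \<and> 1 / Y * deriv (\<lambda>y. y * slope R ?U y) Y = b" if "Y \<in> {0<..<R}" for Y
    using flux[OF that] DERIV_imp_deriv[OF flux[OF that]] that
    by (auto simp: field_differentiable_def)
  with C1 C2 slope[of 0] R show ?thesis
    by (simp add: poiseuille_solution_def classical_solution_def)
qed

theorem theorem2p1:
  fixes R b \<alpha> n c Cu :: real
  assumes "R > 0" and "b > 0" and "\<alpha> > 0" and "c \<in> {0..1}" and "Cu \<ge> 0"
    and "c = 0 \<or> Cu = 0 \<or> n = 1"
  shows "(\<forall>p. carreau_factor \<alpha> n c Cu p = 1)
    \<and> (\<forall>U. carreau_solution R b \<alpha> n c Cu U \<longleftrightarrow> poiseuille_solution R b U)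
    \<and> carreau_solution R b \<alpha> n c Cu (\<lambda>Y. b / 4 * (Y\<^sup>2 - R\<^sup>2))
    \<and> (\<forall>U. carreau_solution R b \<alpha> n c Cu U \<longrightarrow>
          (\<forall>Y\<in>{0..R}. U Y = b / 4 * (Y\<^sup>2 - R\<^sup>2)))"
proof -
  have factor: "carreau_factor \<alpha> n c Cu = (\<lambda>p. 1)"
    using carreau_factor_newtonian[OF assms(6)] by blast
  then have "carreau_solution R b \<alpha> n c Cu = poiseuille_solution R b"
    by (simp add: carreau_solution_def poiseuille_solution_def)
  with factor show ?thesis
    using poiseuille_solution_parabola[OF assms(1)] poiseuille_solution_unique[OF assms(1)]
    by simp
qed

end
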